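(* For a ring $R$, the following conditions are equivalent: (1) $R$ is conjugate nil clean; (2) $J(R)$ is nil and $R/J(R)$ is conjugate nil clean; (3) $J(R)$ is nil and there exists a conjugate nil clean subring $A$ of $R$ such that: (i) $R=A+J(R)$; (ii) every idempotent of $R$ is of the form $e+x$ for some $e=e^2\in A$ and $x\in J(R)$.
   Context: Rings are associative with unity and subrings contain the unity of the overring. $J(R)$ is the Jacobson radical of $R$. An ideal is nil if all its elements are nilpotent. A nil clean decomposition of $a\in R$ is an equation $a=e+l$ with $e=e^2\in R$ and $l\in R$ nilpotent. $R$ is conjugate nil clean if every element of $R$ has a nil clean decomposition and, whenever $a=e+l=f+m$ are two nil clean decompositions of the same element $a\in R$, the idempotents $e,f$ are conjugate in $R$, i.e. $e=ufu^{-1}$ for some unit $u$ of $R$. *)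

theory Defs
  imports "HOL-Algebra.QuotRing" "HOL-Algebra.Subrings"
begin

text \<open>Rings are the (not necessarily commutative, possibly trivial) unital rings of the locale
  \<^locale>\<open>ring\<close>. HOL-Algebra has only two-sided ideals, so left ideals are defined here.\<close>

definition left_ideal :: "'a set \<Rightarrow> ('a, 'b) ring_scheme \<Rightarrow> bool" where
  "left_ideal I R \<longleftrightarrow>
     additive_subgroup I R \<and> (\<forall>a\<in>I. \<forall>x\<in>carrier R. x \<otimes>\<^bsub>R\<^esub> a \<in> I)"

definition maximal_left_ideal :: "'a set \<Rightarrow> ('a, 'b) ring_scheme \<Rightarrow> bool" where
  "maximal_left_ideal M R \<longleftrightarrow>
     left_ideal M R \<and> M \<noteq> carrier R \<and>
     (\<forall>I. left_ideal I R \<and> M \<subseteq> I \<longrightarrow> I = M \<or> I = carrier R)"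

text \<open>The intersection is taken inside the carrier, so it is the whole ring if \<open>R\<close> is trivial and
  thus has no maximal left ideals.\<close>

definition jacobson_radical :: "('a, 'b) ring_scheme \<Rightarrow> 'a set" where
  "jacobson_radical R = {x \<in> carrier R. \<forall>M. maximal_left_ideal M R \<longrightarrow> x \<in> M}"

definition idempotent_elem :: "('a, 'b) ring_scheme \<Rightarrow> 'a \<Rightarrow> bool" where
  "idempotent_elem R e \<longleftrightarrow> e \<in> carrier R \<and> e \<otimes>\<^bsub>R\<^esub> e = e"

definition nilpotent_elem :: "('a, 'b) ring_scheme \<Rightarrow> 'a \<Rightarrow> bool" where
  "nilpotent_elem R x \<longleftrightarrow> x \<in> carrier R \<and> (\<exists>n::nat. x [^]\<^bsub>R\<^esub> n = \<zero>\<^bsub>R\<^esub>)"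

definition nil_set :: "('a, 'b) ring_scheme \<Rightarrow> 'a set \<Rightarrow> bool" where
  "nil_set R I \<longleftrightarrow> (\<forall>x\<in>I. nilpotent_elem R x)"

definition nil_clean_decomp :: "('a, 'b) ring_scheme \<Rightarrow> 'a \<Rightarrow> 'a \<Rightarrow> 'a \<Rightarrow> bool" where
  "nil_clean_decomp R a e l \<longleftrightarrow>
     idempotent_elem R e \<and> nilpotent_elem R l \<and> a = e \<oplus>\<^bsub>R\<^esub> l"

definition conjugate_in :: "('a, 'b) ring_scheme \<Rightarrow> 'a \<Rightarrow> 'a \<Rightarrow> bool" where
  "conjugate_in R e f \<longleftrightarrow> (\<exists>u\<in>Units R. e = u \<otimes>\<^bsub>R\<^esub> f \<otimes>\<^bsub>R\<^esub> inv\<^bsub>R\<^esub> u)"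

definition conjugate_nil_clean :: "('a, 'b) ring_scheme \<Rightarrow> bool" where
  "conjugate_nil_clean R \<longleftrightarrow>
     (\<forall>a\<in>carrier R. \<exists>e l. nil_clean_decomp R a e l) \<and>
     (\<forall>a\<in>carrier R. \<forall>e l f m.
        nil_clean_decomp R a e l \<and> nil_clean_decomp R a f m \<longrightarrow> conjugate_in R e f)"

end

theory Submission
  imports Defs
begin

text \<open>
  Everything rests on one transfer principle: if \<open>h : R \<rightarrow> S\<close> is a surjective ring homomorphism all
  of whose kernel elements are nilpotent, then \<open>R\<close> is conjugate nil clean iff \<open>S\<close> is
  (\<open>nil_kernel_epi.conjugate_nil_clean_iff\<close>). Nilpotency, units and idempotents all lift along such
  an \<open>h\<close>, so nil clean decompositions can be moved in both directions. Conjugacy of idempotents can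
  be moved as well: a unit conjugating the images lifts to a unit of \<open>R\<close>, and two idempotents
  \<open>e, g\<close> with the same image are conjugated by \<open>e g + (1 - e)(1 - g)\<close>, which \<open>h\<close> maps to 1.

  Applied to the projection \<open>R \<rightarrow> R/J(R)\<close>, the principle makes (1) and (2) equivalent as soon as
  \<open>J(R)\<close> is nil. Applied to the restriction \<open>A \<rightarrow> R/J(R)\<close>, which is surjective exactly because
  \<open>R = A + J(R)\<close>, it takes (3) to (2). For (1) implies (3) take \<open>A = R\<close>.

  What remains is that the radical of a conjugate nil clean ring is nil
  (\<open>nil_jacobson_radical\<close>). For \<open>x \<in> J(R)\<close> decompose \<open>1 + x = e + l\<close>. Modulo \<open>J(R)\<close> the
  idempotent \<open>e\<close> equals the unit \<open>1 - l\<close>, so it is 1 there. Hence \<open>1 - e\<close> is an idempotent in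
  \<open>J(R)\<close>, so it is 0, and \<open>x = l\<close> is nilpotent. That \<open>J(R)\<close> is a two-sided ideal and contains no
  nonzero idempotent is derived from its description by maximal left ideals.
\<close>

section \<open>Units, nilpotent elements and conjugate idempotents\<close>

context ring begin

text \<open>This form of conjugacy has no inverse in it, so it composes and passes through
  homomorphisms by plain calculation.\<close>

lemma conjugate_in_iff_intertwined:
  assumes "e \<in> carrier R" "f \<in> carrier R"
  shows "conjugate_in R e f \<longleftrightarrow> (\<exists>u\<in>Units R. e \<otimes> u = u \<otimes> f)"
proof -
  have "e = u \<otimes> f \<otimes> inv u \<longleftrightarrow> e \<otimes> u = u \<otimes> f" if u: "u \<in> Units R" for u
  proof
    assume "e = u \<otimes> f \<otimes> inv u"
    then show "e \<otimes> u = u \<otimes> f"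
      using assms u by (simp add: m_assoc Units_closed)
  next
    assume "e \<otimes> u = u \<otimes> f"
    then have "u \<otimes> f \<otimes> inv u = e \<otimes> (u \<otimes> inv u)"
      using assms u by (simp add: m_assoc[symmetric] Units_closed del: Units_r_inv)
    then show "e = u \<otimes> f \<otimes> inv u"
      using assms u by simp
  qed
  then show ?thesis
    unfolding conjugate_in_def by blast
qed

lemma conjugate_in_trans:
  assumes "conjugate_in R e f" "conjugate_in R f g"
    and carr: "e \<in> carrier R" "f \<in> carrier R" "g \<in> carrier R"
  shows "conjugate_in R e g"
proof -
  obtain u v where u: "u \<in> Units R" "e \<otimes> u = u \<otimes> f" and v: "v \<in> Units R" "f \<otimes> v = v \<otimes> g"
    using assms conjugate_in_iff_intertwined by auto
  note uv = Units_closed[OF u(1)] Units_closed[OF v(1)]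
  have "e \<otimes> (u \<otimes> v) = (e \<otimes> u) \<otimes> v"
    using uv carr by (simp add: m_assoc)
  also have "\<dots> = u \<otimes> (f \<otimes> v)"
    unfolding u(2) using uv carr by (simp add: m_assoc)
  also have "\<dots> = (u \<otimes> v) \<otimes> g"
    unfolding v(2) using uv carr by (simp add: m_assoc)
  finally show ?thesis
    using u v carr conjugate_in_iff_intertwined by blast
qed

text \<open>The cofactor is the geometric sum \<open>1 + x + \<dots> + x^(n-1)\<close>; the induction builds it one
  summand at a time. If \<open>x^n = 0\<close>, it is a two-sided inverse of \<open>1 - x\<close>.\<close>

lemma one_minus_dvd_one_minus_pow:
  assumes x: "x \<in> carrier R"
  shows "\<exists>s\<in>carrier R. (\<one> \<ominus> x) \<otimes> s = \<one> \<ominus> x [^] (n::nat) \<and> s \<otimes> (\<one> \<ominus> x) = \<one> \<ominus> x [^] n"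
proof (induction n)
  case 0
  show ?case using x by (intro bexI[of _ \<zero>]) (auto simp: r_neg minus_eq)
next
  case (Suc n)
  then obtain s where s: "s \<in> carrier R" "(\<one> \<ominus> x) \<otimes> s = \<one> \<ominus> x [^] n"
    "s \<otimes> (\<one> \<ominus> x) = \<one> \<ominus> x [^] n" by blast
  have p: "x [^] n \<in> carrier R" "x \<otimes> x [^] n = x [^] n \<otimes> x"
    using x nat_pow_Suc2[of x n] by simp_all
  have "(\<one> \<ominus> x) \<otimes> (s \<oplus> x [^] n) = (\<one> \<ominus> x [^] n) \<oplus> (\<one> \<ominus> x) \<otimes> x [^] n"
    using s(1) s(2)[symmetric] x p by (simp add: r_distr)
  also have "\<dots> = \<one> \<ominus> x \<otimes> x [^] n"
    using x p(1) by algebra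
  finally have 1: "(\<one> \<ominus> x) \<otimes> (s \<oplus> x [^] n) = \<one> \<ominus> x [^] Suc n"
    using p by simp
  have "(s \<oplus> x [^] n) \<otimes> (\<one> \<ominus> x) = (\<one> \<ominus> x [^] n) \<oplus> x [^] n \<otimes> (\<one> \<ominus> x)"
    using s(1) s(3)[symmetric] x p by (simp add: l_distr)
  also have "\<dots> = \<one> \<ominus> x [^] n \<otimes> x"
  proof -
    have "x [^] n \<otimes> (\<one> \<ominus> x) = x [^] n \<ominus> x [^] n \<otimes> x"
      using x p(1) by (simp add: minus_eq r_distr r_minus)
    moreover have "(\<one> \<ominus> x [^] n) \<oplus> (x [^] n \<ominus> x [^] n \<otimes> x) = \<one> \<ominus> x [^] n \<otimes> x"
      using x p(1) by algebra
    ultimately show ?thesis by simp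
  qed
  finally have 2: "(s \<oplus> x [^] n) \<otimes> (\<one> \<ominus> x) = \<one> \<ominus> x [^] Suc n"
    by simp
  show ?case using 1 2 s(1) p(1) by blast
qed

lemma one_minus_nilpotent_in_Units:
  assumes "nilpotent_elem R x"
  shows "\<one> \<ominus> x \<in> Units R"
proof -
  obtain n :: nat where x: "x \<in> carrier R" and n: "x [^] n = \<zero>"
    using assms unfolding nilpotent_elem_def by blast
  have "\<one> \<ominus> x [^] n = \<one>" unfolding n by (simp add: minus_eq)
  then show ?thesis
    using one_minus_dvd_one_minus_pow[OF x, of n] x unfolding Units_def by auto
qed

lemma Units_of_one_sided_inverses:
  assumes carr: "u \<in> carrier R" "v \<in> carrier R" "w \<in> carrier R"
    and "v \<otimes> u = \<one>" "u \<otimes> w = \<one>"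
  shows "u \<in> Units R"
proof -
  have "v = v \<otimes> (u \<otimes> w)" using carr(2) \<open>u \<otimes> w = \<one>\<close> by simp
  also have "\<dots> = w"
    using carr \<open>v \<otimes> u = \<one>\<close> by (simp only: m_assoc[symmetric] l_one)
  finally show ?thesis using assms unfolding Units_def by auto
qed

lemma commute_inv:
  assumes u: "u \<in> Units R" and a: "a \<in> carrier R" and "a \<otimes> u = u \<otimes> a"
  shows "a \<otimes> inv u = inv u \<otimes> a"
proof -
  have uc: "u \<in> carrier R" "inv u \<in> carrier R" using u by auto
  have "a \<otimes> inv u = inv u \<otimes> (u \<otimes> a) \<otimes> inv u"
    using u uc a by (simp add: m_assoc[symmetric])
  also have "\<dots> = inv u \<otimes> (a \<otimes> u) \<otimes> inv u" using assms by simp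
  also have "\<dots> = inv u \<otimes> a"
    using u uc a by (simp add: m_assoc)
  finally show ?thesis .
qed

lemma idempotent_pow:
  assumes "idempotent_elem R e" "n > (0::nat)"
  shows "e [^] n = e"
  using assms(2)
proof (induction n)
  case (Suc n)
  then show ?case using assms(1) by (cases n) (auto simp: idempotent_elem_def)
qed simp

lemma idempotent_complement:
  assumes "idempotent_elem R e"
  shows "idempotent_elem R (\<one> \<ominus> e)" "e \<otimes> (\<one> \<ominus> e) = \<zero>" "(\<one> \<ominus> e) \<otimes> e = \<zero>"
proof -
  have e: "e \<in> carrier R" "e \<otimes> e = e" using assms by (auto simp: idempotent_elem_def)
  show 1: "e \<otimes> (\<one> \<ominus> e) = \<zero>" "(\<one> \<ominus> e) \<otimes> e = \<zero>"
    using e by (simp_all add: minus_eq r_distr l_distr r_minus l_minus r_neg)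
  have "(\<one> \<ominus> e) \<otimes> (\<one> \<ominus> e) = (\<one> \<ominus> e) \<ominus> e \<otimes> (\<one> \<ominus> e)"
    using e(1) by algebra
  then show "idempotent_elem R (\<one> \<ominus> e)"
    using e 1 by (simp add: idempotent_elem_def minus_eq)
qed

end

section \<open>Transfer along surjective ring homomorphisms with nil kernel\<close>

context ring_hom_ring begin

lemma hom_minus: "x \<in> carrier R \<Longrightarrow> y \<in> carrier R \<Longrightarrow> h (x \<ominus>\<^bsub>R\<^esub> y) = h x \<ominus>\<^bsub>S\<^esub> h y"
  by (simp add: R.minus_eq S.minus_eq)

lemma hom_idempotent: "idempotent_elem R e \<Longrightarrow> idempotent_elem S (h e)"
  unfolding idempotent_elem_def by (metis hom_closed hom_mult)

lemma hom_Units: "u \<in> Units R \<Longrightarrow> h u \<in> Units S"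
  by (metis R.Units_closed R.Units_inv_closed R.Units_l_inv R.Units_r_inv S.Units_of_one_sided_inverses
      hom_closed hom_mult hom_one)

lemma hom_nilpotent:
  assumes "nilpotent_elem R x"
  shows "nilpotent_elem S (h x)"
  using assms unfolding nilpotent_elem_def by (metis hom_closed hom_nat_pow hom_zero)

lemma hom_nil_clean_decomp:
  assumes "nil_clean_decomp R a e l"
  shows "nil_clean_decomp S (h a) (h e) (h l)"
  using assms hom_idempotent hom_nilpotent
  unfolding nil_clean_decomp_def idempotent_elem_def nilpotent_elem_def by (metis hom_add)

lemma hom_conjugate:
  assumes "conjugate_in R e f" "e \<in> carrier R" "f \<in> carrier R"
  shows "conjugate_in S (h e) (h f)"
proof -
  obtain u where u: "u \<in> Units R" "e \<otimes>\<^bsub>R\<^esub> u = u \<otimes>\<^bsub>R\<^esub> f"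
    using assms R.conjugate_in_iff_intertwined by auto
  have "h e \<otimes>\<^bsub>S\<^esub> h u = h (e \<otimes>\<^bsub>R\<^esub> u)"
    using u(1) assms by (simp add: R.Units_closed)
  also have "\<dots> = h u \<otimes>\<^bsub>S\<^esub> h f"
    unfolding u(2) using u(1) assms by (simp add: R.Units_closed)
  finally show ?thesis
    using hom_Units[OF u(1)] assms by (auto simp: S.conjugate_in_iff_intertwined)
qed

end

text \<open>The kernel condition is stated on elements rather than on a quotient, so that the locale covers
  both \<open>R \<rightarrow> R/I\<close> and the map \<open>A \<rightarrow> R/I\<close> from a subring \<open>A\<close> without first identifying its image
  or kernel.\<close>

locale nil_kernel_epi = ring_hom_ring +
  assumes surj: "h ` carrier R = carrier S"
    and nil_kernel: "\<lbrakk>x \<in> carrier R; h x = \<zero>\<^bsub>S\<^esub>\<rbrakk> \<Longrightarrow> nilpotent_elem R x"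

context nil_kernel_epi begin

lemma preimage_ex:
  assumes "y \<in> carrier S"
  obtains x where "x \<in> carrier R" "h x = y"
proof -
  have "y \<in> h ` carrier R" using assms unfolding surj .
  then show ?thesis using that by (elim imageE) simp
qed

lemma Units_if_hom_one:
  assumes "u \<in> carrier R" "h u = \<one>\<^bsub>S\<^esub>"
  shows "u \<in> Units R"
proof -
  have "nilpotent_elem R (\<one>\<^bsub>R\<^esub> \<ominus>\<^bsub>R\<^esub> u)"
    using assms by (intro nil_kernel) (simp_all add: hom_minus S.r_neg S.minus_eq)
  then have "\<one>\<^bsub>R\<^esub> \<ominus>\<^bsub>R\<^esub> (\<one>\<^bsub>R\<^esub> \<ominus>\<^bsub>R\<^esub> u) \<in> Units R"
    by (rule R.one_minus_nilpotent_in_Units)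
  moreover have "\<one>\<^bsub>R\<^esub> \<ominus>\<^bsub>R\<^esub> (\<one>\<^bsub>R\<^esub> \<ominus>\<^bsub>R\<^esub> u) = u"
    using assms(1) by algebra
  ultimately show ?thesis by simp
qed

text \<open>If \<open>h v\<close> is the inverse of \<open>h u\<close>, then \<open>h\<close> maps both \<open>u v\<close> and \<open>v u\<close> to 1. So both are units,
  and \<open>u\<close> is invertible from both sides.\<close>

lemma Units_if_hom_Units:
  assumes u: "u \<in> carrier R" "h u \<in> Units S"
  shows "u \<in> Units R"
proof -
  obtain v where v: "v \<in> carrier R" "h v = inv\<^bsub>S\<^esub> (h u)"
    using preimage_ex[OF S.Units_inv_closed[OF u(2)]] .
  have 1: "u \<otimes>\<^bsub>R\<^esub> v \<in> Units R" "v \<otimes>\<^bsub>R\<^esub> u \<in> Units R"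
    using u v by (auto intro!: Units_if_hom_one)
  show ?thesis
  proof (rule R.Units_of_one_sided_inverses)
    show "inv\<^bsub>R\<^esub> (v \<otimes>\<^bsub>R\<^esub> u) \<otimes>\<^bsub>R\<^esub> v \<otimes>\<^bsub>R\<^esub> u = \<one>\<^bsub>R\<^esub>"
      using 1 u v by (simp add: R.m_assoc)
    show "u \<otimes>\<^bsub>R\<^esub> (v \<otimes>\<^bsub>R\<^esub> inv\<^bsub>R\<^esub> (u \<otimes>\<^bsub>R\<^esub> v)) = \<one>\<^bsub>R\<^esub>"
      using 1 u v by (simp add: R.m_assoc[symmetric])
  qed (use 1 u v in auto)
qed

lemma nilpotent_if_hom_nilpotent:
  assumes x: "x \<in> carrier R" and "nilpotent_elem S (h x)"
  shows "nilpotent_elem R x"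
proof -
  obtain n :: nat where "h (x [^]\<^bsub>R\<^esub> n) = \<zero>\<^bsub>S\<^esub>"
    using assms unfolding nilpotent_elem_def by (metis hom_nat_pow)
  then have "nilpotent_elem R (x [^]\<^bsub>R\<^esub> n)"
    using x by (intro nil_kernel) auto
  then show ?thesis
    using x unfolding nilpotent_elem_def by (metis R.nat_pow_pow)
qed

text \<open>Let \<open>a\<close> be any preimage of the idempotent and \<open>b = 1 - a\<close>. The product \<open>a b\<close> lies in the kernel,
  so \<open>p = a^n\<close> and \<open>q = b^n\<close> annihilate each other for large \<open>n\<close>. Their sum \<open>u\<close> is mapped to 1, as
  \<open>h p = h a\<close> and \<open>h q = 1 - h a\<close>, so it is a unit; it commutes with \<open>p\<close> and \<open>q\<close>. Therefore
  \<open>p/u + q/u = 1\<close> is a decomposition of 1 into orthogonal summands, and \<open>p/u\<close> is the idempotent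
  sought.\<close>

lemma idempotent_lift:
  assumes "idempotent_elem S e'"
  shows "\<exists>e. idempotent_elem R e \<and> h e = e'"
proof -
  have e': "e' \<in> carrier S"
    using assms by (simp add: idempotent_elem_def)
  obtain a where a: "a \<in> carrier R" "h a = e'"
    using preimage_ex[OF e'] .
  define b where "b = \<one>\<^bsub>R\<^esub> \<ominus>\<^bsub>R\<^esub> a"
  have b: "b \<in> carrier R" "h b = \<one>\<^bsub>S\<^esub> \<ominus>\<^bsub>S\<^esub> e'"
    using a by (simp_all add: b_def hom_minus)
  have ab: "a \<otimes>\<^bsub>R\<^esub> b = b \<otimes>\<^bsub>R\<^esub> a"
    using a(1) by (simp add: b_def R.minus_eq R.r_distr R.l_distr R.r_minus R.l_minus)
  have "nilpotent_elem R (a \<otimes>\<^bsub>R\<^esub> b)"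
    using a b S.idempotent_complement(2)[OF assms] by (intro nil_kernel) simp_all
  then obtain m :: nat where m: "(a \<otimes>\<^bsub>R\<^esub> b) [^]\<^bsub>R\<^esub> m = \<zero>\<^bsub>R\<^esub>"
    unfolding nilpotent_elem_def by blast
  \<comment> \<open>The exponent must be positive: the power 0 would not map to the given idempotent.\<close>
  define p q where "p = a [^]\<^bsub>R\<^esub> Suc m" and "q = b [^]\<^bsub>R\<^esub> Suc m"
  define u where "u = p \<oplus>\<^bsub>R\<^esub> q"
  have carr: "p \<in> carrier R" "q \<in> carrier R" "u \<in> carrier R"
    using a b by (auto simp: p_def q_def u_def)
  have hp: "h p = e'"
    unfolding p_def hom_nat_pow[OF a(1)] a(2)
    by (rule S.idempotent_pow[OF assms]) simp
  have hq: "h q = \<one>\<^bsub>S\<^esub> \<ominus>\<^bsub>S\<^esub> e'"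
    unfolding q_def hom_nat_pow[OF b(1)] b(2)
    by (rule S.idempotent_pow[OF S.idempotent_complement(1)[OF assms]]) simp
  have "p \<otimes>\<^bsub>R\<^esub> q = (a \<otimes>\<^bsub>R\<^esub> b) [^]\<^bsub>R\<^esub> Suc m"
    unfolding p_def q_def by (rule R.pow_mult_distrib[OF ab a(1) b(1), symmetric])
  then have pq: "p \<otimes>\<^bsub>R\<^esub> q = \<zero>\<^bsub>R\<^esub>"
    using m a b by simp
  have comm: "p \<otimes>\<^bsub>R\<^esub> q = q \<otimes>\<^bsub>R\<^esub> p"
    unfolding p_def q_def R.pow_mult_distrib[OF ab a(1) b(1), symmetric]
      R.pow_mult_distrib[OF ab[symmetric] b(1) a(1), symmetric] ab ..
  have "h u = e' \<oplus>\<^bsub>S\<^esub> (\<one>\<^bsub>S\<^esub> \<ominus>\<^bsub>S\<^esub> e')"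
    using carr(1,2) by (simp add: u_def hp hq)
  also have "\<dots> = \<one>\<^bsub>S\<^esub>" using e' by algebra
  finally have hu: "h u = \<one>\<^bsub>S\<^esub>" .
  then have u: "u \<in> Units R" using carr by (intro Units_if_hom_one)
  define w where "w = inv\<^bsub>R\<^esub> u"
  have w: "w \<in> carrier R" "u \<otimes>\<^bsub>R\<^esub> w = \<one>\<^bsub>R\<^esub>" using u by (auto simp: w_def)
  have "q \<otimes>\<^bsub>R\<^esub> u = u \<otimes>\<^bsub>R\<^esub> q"
    using carr comm by (simp add: u_def R.l_distr R.r_distr)
  then have qw: "q \<otimes>\<^bsub>R\<^esub> w = w \<otimes>\<^bsub>R\<^esub> q"
    unfolding w_def using u carr(2) by (rule R.commute_inv[rotated 2])
  define e where "e = p \<otimes>\<^bsub>R\<^esub> w"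
  have e: "e \<in> carrier R" using carr w by (simp add: e_def)
  have 1: "e \<oplus>\<^bsub>R\<^esub> q \<otimes>\<^bsub>R\<^esub> w = \<one>\<^bsub>R\<^esub>"
    using w carr by (simp add: e_def R.l_distr[symmetric] u_def)
  have "e \<otimes>\<^bsub>R\<^esub> (q \<otimes>\<^bsub>R\<^esub> w) = p \<otimes>\<^bsub>R\<^esub> (w \<otimes>\<^bsub>R\<^esub> q) \<otimes>\<^bsub>R\<^esub> w"
    using w carr by (simp add: e_def R.m_assoc)
  also have "\<dots> = (p \<otimes>\<^bsub>R\<^esub> q) \<otimes>\<^bsub>R\<^esub> w \<otimes>\<^bsub>R\<^esub> w"
    using w carr by (simp add: qw[symmetric] R.m_assoc)
  also have "\<dots> = \<zero>\<^bsub>R\<^esub>" using pq w by simp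
  finally have "e \<otimes>\<^bsub>R\<^esub> (q \<otimes>\<^bsub>R\<^esub> w) = \<zero>\<^bsub>R\<^esub>" .
  moreover have "e \<otimes>\<^bsub>R\<^esub> (e \<oplus>\<^bsub>R\<^esub> q \<otimes>\<^bsub>R\<^esub> w) = e \<otimes>\<^bsub>R\<^esub> e \<oplus>\<^bsub>R\<^esub> e \<otimes>\<^bsub>R\<^esub> (q \<otimes>\<^bsub>R\<^esub> w)"
    using e w carr by (simp add: R.r_distr)
  ultimately have "idempotent_elem R e"
    using 1 e by (simp add: idempotent_elem_def)
  moreover have "h e = e'"
  proof -
    have "h w = h u \<otimes>\<^bsub>S\<^esub> h w" using w(1) hu by simp
    also have "\<dots> = h (u \<otimes>\<^bsub>R\<^esub> w)" using w(1) carr(3) by simp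
    also have "\<dots> = \<one>\<^bsub>S\<^esub>" using w(2) by simp
    finally show ?thesis using hp carr(1) w(1) e' by (simp add: e_def)
  qed
  ultimately show ?thesis by blast
qed

text \<open>The element \<open>v = e g + (1 - e)(1 - g)\<close> satisfies \<open>e v = e g = v g\<close>. Since \<open>h e = h g\<close>, its
  image is \<open>h g + (1 - h g) = 1\<close>, so \<open>v\<close> is a unit.\<close>

lemma idempotents_conjugate_if_hom_eq:
  assumes "idempotent_elem R e" "idempotent_elem R g" "h e = h g"
  shows "conjugate_in R e g"
proof -
  have e: "e \<in> carrier R" "e \<otimes>\<^bsub>R\<^esub> e = e" and g: "g \<in> carrier R" "g \<otimes>\<^bsub>R\<^esub> g = g"
    using assms by (auto simp: idempotent_elem_def)
  define e2 g2 where "e2 = \<one>\<^bsub>R\<^esub> \<ominus>\<^bsub>R\<^esub> e" and "g2 = \<one>\<^bsub>R\<^esub> \<ominus>\<^bsub>R\<^esub> g"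
  have e2: "e2 \<in> carrier R" "e \<otimes>\<^bsub>R\<^esub> e2 = \<zero>\<^bsub>R\<^esub>" and g2: "g2 \<in> carrier R" "g2 \<otimes>\<^bsub>R\<^esub> g = \<zero>\<^bsub>R\<^esub>"
    using e g R.idempotent_complement assms by (auto simp: e2_def g2_def)
  define v where "v = e \<otimes>\<^bsub>R\<^esub> g \<oplus>\<^bsub>R\<^esub> e2 \<otimes>\<^bsub>R\<^esub> g2"
  have v: "v \<in> carrier R" using e g e2 g2 by (simp add: v_def)
  have "h e2 = h g2" using e g assms by (simp add: e2_def g2_def hom_minus)
  moreover have "h g2 \<otimes>\<^bsub>S\<^esub> h g2 = h g2"
    using hom_idempotent[OF R.idempotent_complement(1)[OF assms(2)]]
    by (simp add: g2_def idempotent_elem_def)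
  moreover have "h g \<otimes>\<^bsub>S\<^esub> h g = h g" using g by (metis hom_mult)
  ultimately have "h v = h g \<oplus>\<^bsub>S\<^esub> h g2"
    using e g e2 g2 assms by (simp add: v_def)
  also have "\<dots> = h (g \<oplus>\<^bsub>R\<^esub> g2)" using g g2 by simp
  also have "g \<oplus>\<^bsub>R\<^esub> g2 = \<one>\<^bsub>R\<^esub>" using g(1) unfolding g2_def by algebra
  finally have "v \<in> Units R" using v by (intro Units_if_hom_one) simp_all
  moreover have "e \<otimes>\<^bsub>R\<^esub> v = v \<otimes>\<^bsub>R\<^esub> g"
  proof -
    have "e \<otimes>\<^bsub>R\<^esub> v = (e \<otimes>\<^bsub>R\<^esub> e) \<otimes>\<^bsub>R\<^esub> g \<oplus>\<^bsub>R\<^esub> (e \<otimes>\<^bsub>R\<^esub> e2) \<otimes>\<^bsub>R\<^esub> g2"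
      using e(1) g(1) e2(1) g2(1) by (simp add: v_def R.r_distr R.m_assoc)
    also have "\<dots> = e \<otimes>\<^bsub>R\<^esub> (g \<otimes>\<^bsub>R\<^esub> g) \<oplus>\<^bsub>R\<^esub> e2 \<otimes>\<^bsub>R\<^esub> (g2 \<otimes>\<^bsub>R\<^esub> g)"
      using e g e2 g2 by simp
    also have "\<dots> = v \<otimes>\<^bsub>R\<^esub> g"
      using e(1) g(1) e2(1) g2(1) by (simp add: v_def R.l_distr R.m_assoc)
    finally show ?thesis .
  qed
  ultimately show ?thesis
    using e g R.conjugate_in_iff_intertwined by blast
qed

text \<open>Lift a conjugating unit to \<open>u\<close>. The idempotent \<open>g = u f u\<inverse>\<close> is conjugate to \<open>f\<close>, and it has
  the same image as \<open>e\<close>, so it is conjugate to \<open>e\<close>.\<close>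

lemma conjugate_if_hom_conjugate:
  assumes e: "idempotent_elem R e" and f: "idempotent_elem R f"
    and "conjugate_in S (h e) (h f)"
  shows "conjugate_in R e f"
proof -
  have carr: "e \<in> carrier R" "f \<in> carrier R"
    using e f by (auto simp: idempotent_elem_def)
  obtain u' where u': "u' \<in> Units S" "h e = u' \<otimes>\<^bsub>S\<^esub> h f \<otimes>\<^bsub>S\<^esub> inv\<^bsub>S\<^esub> u'"
    using assms unfolding conjugate_in_def by blast
  obtain u where hu: "u \<in> carrier R" "h u = u'"
    using preimage_ex[OF S.Units_closed[OF u'(1)]] .
  with u' have u: "u \<in> Units R" using Units_if_hom_Units by simp
  have uc: "u \<in> carrier R" "inv\<^bsub>R\<^esub> u \<in> carrier R" using u by auto
  define g where "g = u \<otimes>\<^bsub>R\<^esub> f \<otimes>\<^bsub>R\<^esub> inv\<^bsub>R\<^esub> u"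
  have gc: "g \<in> carrier R" using uc carr by (simp add: g_def)
  have "h u \<otimes>\<^bsub>S\<^esub> h (inv\<^bsub>R\<^esub> u) = \<one>\<^bsub>S\<^esub>" "h (inv\<^bsub>R\<^esub> u) \<otimes>\<^bsub>S\<^esub> h u = \<one>\<^bsub>S\<^esub>"
    using u uc by (simp_all flip: hom_mult)
  then have "h (inv\<^bsub>R\<^esub> u) = inv\<^bsub>S\<^esub> u'"
    using S.inv_unique'[of "h u" "h (inv\<^bsub>R\<^esub> u)"] uc unfolding hu(2)[symmetric] by simp
  then have hg: "h e = h g"
    using uc carr hu(2) u'(2) by (simp add: g_def)
  have "g \<otimes>\<^bsub>R\<^esub> u = u \<otimes>\<^bsub>R\<^esub> f"
    using u uc carr by (simp add: g_def R.m_assoc)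
  then have conj: "conjugate_in R g f"
    using u carr gc R.conjugate_in_iff_intertwined by blast
  have "g \<otimes>\<^bsub>R\<^esub> g = g \<otimes>\<^bsub>R\<^esub> u \<otimes>\<^bsub>R\<^esub> (f \<otimes>\<^bsub>R\<^esub> inv\<^bsub>R\<^esub> u)"
    using uc carr gc by (simp add: R.m_assoc) (simp add: g_def R.m_assoc)
  also have "\<dots> = u \<otimes>\<^bsub>R\<^esub> (f \<otimes>\<^bsub>R\<^esub> f) \<otimes>\<^bsub>R\<^esub> inv\<^bsub>R\<^esub> u"
    using uc carr \<open>g \<otimes>\<^bsub>R\<^esub> u = u \<otimes>\<^bsub>R\<^esub> f\<close> by (simp add: R.m_assoc)
  finally have "idempotent_elem R g"
    using f gc by (simp add: idempotent_elem_def g_def)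
  then have "conjugate_in R e g"
    using e hg by (intro idempotents_conjugate_if_hom_eq)
  then show ?thesis
    using conj carr gc R.conjugate_in_trans by blast
qed

text \<open>The delicate direction is uniqueness in \<open>S\<close>: two decompositions \<open>e' + l' = f' + m'\<close> must be
  lifted to decompositions of one and the same element of \<open>R\<close>. So \<open>e, f, l\<close> are lifted freely and
  \<open>m\<close> is forced to be \<open>e + l - f\<close>; it is nilpotent because its image \<open>m'\<close> is.\<close>

theorem conjugate_nil_clean_iff: "conjugate_nil_clean R \<longleftrightarrow> conjugate_nil_clean S"
proof
  assume R: "conjugate_nil_clean R"
  show "conjugate_nil_clean S"
    unfolding conjugate_nil_clean_def
  proof (intro conjI ballI allI impI; (elim conjE)?)
    fix a' assume "a' \<in> carrier S"
    then obtain a where a: "a \<in> carrier R" "h a = a'" by (rule preimage_ex)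
    then obtain e l where "nil_clean_decomp R a e l"
      using R unfolding conjugate_nil_clean_def by blast
    then show "\<exists>e l. nil_clean_decomp S a' e l"
      using hom_nil_clean_decomp[of a e l] a(2) by blast
  next
    fix a' e' l' f' m'
    assume d: "nil_clean_decomp S a' e' l'" "nil_clean_decomp S a' f' m'"
    have S: "e' \<in> carrier S" "f' \<in> carrier S" "l' \<in> carrier S" "m' \<in> carrier S"
      using d by (auto simp: nil_clean_decomp_def idempotent_elem_def nilpotent_elem_def)
    obtain e where e: "idempotent_elem R e" "h e = e'"
      using idempotent_lift[of e'] d(1) by (auto simp: nil_clean_decomp_def)
    obtain f where f: "idempotent_elem R f" "h f = f'"
      using idempotent_lift[of f'] d(2) by (auto simp: nil_clean_decomp_def)
    obtain l where l: "l \<in> carrier R" "h l = l'" using preimage_ex[OF S(3)] .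
    have carr: "e \<in> carrier R" "f \<in> carrier R" using e f by (auto simp: idempotent_elem_def)
    define m where "m = (e \<oplus>\<^bsub>R\<^esub> l) \<ominus>\<^bsub>R\<^esub> f"
    have m: "m \<in> carrier R" using carr l by (simp add: m_def)
    have "h m = (e' \<oplus>\<^bsub>S\<^esub> l') \<ominus>\<^bsub>S\<^esub> f'" using carr l e f by (simp add: m_def hom_minus)
    also have "\<dots> = (f' \<oplus>\<^bsub>S\<^esub> m') \<ominus>\<^bsub>S\<^esub> f'" using d by (simp add: nil_clean_decomp_def)
    also have "\<dots> = m'" using S(2,4) by algebra
    finally have hm: "h m = m'" .
    have "nilpotent_elem R l" "nilpotent_elem R m"
      using nilpotent_if_hom_nilpotent[OF l(1)] nilpotent_if_hom_nilpotent[OF m] l(2) hm d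
      by (simp_all add: nil_clean_decomp_def)
    moreover have "e \<oplus>\<^bsub>R\<^esub> l = f \<oplus>\<^bsub>R\<^esub> m"
      using carr l(1) unfolding m_def by algebra
    ultimately have "nil_clean_decomp R (e \<oplus>\<^bsub>R\<^esub> l) e l" "nil_clean_decomp R (e \<oplus>\<^bsub>R\<^esub> l) f m"
      using e(1) f(1) by (simp_all add: nil_clean_decomp_def)
    moreover have "e \<oplus>\<^bsub>R\<^esub> l \<in> carrier R" using carr(1) l(1) by simp
    ultimately have "conjugate_in R e f"
      using R unfolding conjugate_nil_clean_def by blast
    then show "conjugate_in S e' f'"
      using hom_conjugate[of e f] carr e(2) f(2) by simp
  qed
next
  assume S: "conjugate_nil_clean S"
  show "conjugate_nil_clean R"
    unfolding conjugate_nil_clean_def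
  proof (intro conjI ballI allI impI; (elim conjE)?)
    fix a assume a: "a \<in> carrier R"
    then obtain e' l' where d: "nil_clean_decomp S (h a) e' l'"
      using S hom_closed[OF a] unfolding conjugate_nil_clean_def by blast
    then have e': "idempotent_elem S e'" and l': "nilpotent_elem S l'" and ha: "h a = e' \<oplus>\<^bsub>S\<^esub> l'"
      by (simp_all add: nil_clean_decomp_def)
    obtain e where e: "idempotent_elem R e" "h e = e'"
      using idempotent_lift[OF e'] by blast
    have carr: "e \<in> carrier R" "e' \<in> carrier S" "l' \<in> carrier S"
      using e(1) e' l' by (simp_all add: idempotent_elem_def nilpotent_elem_def)
    have "h (a \<ominus>\<^bsub>R\<^esub> e) = (e' \<oplus>\<^bsub>S\<^esub> l') \<ominus>\<^bsub>S\<^esub> e'"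
      using a carr(1) e(2) ha by (simp add: hom_minus)
    also have "\<dots> = l'" using carr(2,3) by algebra
    finally have "nilpotent_elem R (a \<ominus>\<^bsub>R\<^esub> e)"
      using nilpotent_if_hom_nilpotent[of "a \<ominus>\<^bsub>R\<^esub> e"] a carr(1) l'
      by simp
    moreover have "a = e \<oplus>\<^bsub>R\<^esub> (a \<ominus>\<^bsub>R\<^esub> e)" using a carr(1) by algebra
    ultimately have "nil_clean_decomp R a e (a \<ominus>\<^bsub>R\<^esub> e)"
      unfolding nil_clean_decomp_def using e(1) by blast
    then show "\<exists>e l. nil_clean_decomp R a e l" by blast
  next
    fix a e l f m
    assume a: "a \<in> carrier R" and d: "nil_clean_decomp R a e l" "nil_clean_decomp R a f m"
    have "conjugate_in S (h e) (h f)"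
      using S hom_nil_clean_decomp[OF d(1)] hom_nil_clean_decomp[OF d(2)] hom_closed[OF a]
      unfolding conjugate_nil_clean_def by blast
    then show "conjugate_in R e f"
      using d by (intro conjugate_if_hom_conjugate) (simp_all add: nil_clean_decomp_def)
  qed
qed

end

section \<open>The Jacobson radical\<close>

lemma left_idealD:
  assumes "left_ideal I R"
  shows "I \<subseteq> carrier R" "\<zero>\<^bsub>R\<^esub> \<in> I"
    "\<And>a b. a \<in> I \<Longrightarrow> b \<in> I \<Longrightarrow> a \<oplus>\<^bsub>R\<^esub> b \<in> I"
    "\<And>x a. x \<in> carrier R \<Longrightarrow> a \<in> I \<Longrightarrow> x \<otimes>\<^bsub>R\<^esub> a \<in> I"
proof -
  interpret additive_subgroup I R using assms by (simp add: left_ideal_def)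
  show "I \<subseteq> carrier R" by (rule a_subset)
  show "\<zero>\<^bsub>R\<^esub> \<in> I" by (rule zero_closed)
  show "a \<oplus>\<^bsub>R\<^esub> b \<in> I" if "a \<in> I" "b \<in> I" for a b using that by (rule a_closed)
  show "x \<otimes>\<^bsub>R\<^esub> a \<in> I" if "x \<in> carrier R" "a \<in> I" for x a
    using that assms by (simp add: left_ideal_def)
qed

context ring begin

lemma left_idealI:
  assumes "I \<subseteq> carrier R" "\<zero> \<in> I"
    and "\<And>a b. a \<in> I \<Longrightarrow> b \<in> I \<Longrightarrow> a \<oplus> b \<in> I"
    and l: "\<And>x a. x \<in> carrier R \<Longrightarrow> a \<in> I \<Longrightarrow> x \<otimes> a \<in> I"
  shows "left_ideal I R"
proof -
  have "\<ominus> a \<in> I" if "a \<in> I" for a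
  proof -
    have "a \<in> carrier R" using that assms(1) by (rule subsetD[rotated])
    then have "(\<ominus> \<one>) \<otimes> a = \<ominus> a" by (simp add: l_minus)
    then show ?thesis using l[of "\<ominus> \<one>" a] that by simp
  qed
  then have "subgroup I (add_monoid R)"
    using assms(1-3) by (intro add.subgroupI) (auto simp: a_inv_def)
  then show ?thesis
    using l by (simp add: left_ideal_def additive_subgroup_def)
qed

lemma left_ideal_eq_carrier:
  assumes "left_ideal I R" "\<one> \<in> I"
  shows "I = carrier R"
proof
  show "I \<subseteq> carrier R" using assms(1) by (rule left_idealD)
  show "carrier R \<subseteq> I"
  proof
    fix x assume "x \<in> carrier R"
    then show "x \<in> I" using left_idealD(4)[OF assms(1), of x \<one>] assms(2) by simp
  qed
qed

lemma maximal_left_ideal_ex: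
  assumes I: "left_ideal I R" "\<one> \<notin> I"
  shows "\<exists>M. maximal_left_ideal M R \<and> I \<subseteq> M"
proof -
  define P where "P = {K. left_ideal K R \<and> \<one> \<notin> K \<and> I \<subseteq> K}"
  have "\<exists>M\<in>P. \<forall>X\<in>P. M \<subseteq> X \<longrightarrow> X = M"
  proof (rule subset_Zorn_nonempty)
    show "P \<noteq> {}" using I by (auto simp: P_def)
  next
    fix C assume C: "C \<noteq> {}" "subset.chain P C"
    then have K: "left_ideal K R" "\<one> \<notin> K" "I \<subseteq> K" if "K \<in> C" for K
      using that by (auto simp: P_def subset.chain_def)
    have chain: "K \<subseteq> L \<or> L \<subseteq> K" if "K \<in> C" "L \<in> C" for K L
      using C that unfolding subset_chain_def by blast
    have "left_ideal (\<Union>C) R"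
    proof (rule left_idealI)
      show "\<Union>C \<subseteq> carrier R" using left_idealD(1)[OF K(1)] by blast
      show "\<zero> \<in> \<Union>C" using left_idealD(2)[OF K(1)] C(1) by blast
      show "x \<otimes> a \<in> \<Union>C" if "x \<in> carrier R" "a \<in> \<Union>C" for x a
        using that left_idealD(4)[OF K(1)] by blast
      show "a \<oplus> b \<in> \<Union>C" if ab: "a \<in> \<Union>C" "b \<in> \<Union>C" for a b
      proof -
        obtain K L where KL: "a \<in> K" "K \<in> C" "b \<in> L" "L \<in> C" using ab by blast
        then obtain T where "T \<in> C" "a \<in> T" "b \<in> T" using chain by blast
        then show ?thesis using left_idealD(3)[OF K(1)] by blast
      qed
    qed
    moreover have "\<one> \<notin> \<Union>C" "I \<subseteq> \<Union>C" using K(2,3) C(1) by blast+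
    ultimately show "\<Union>C \<in> P" by (simp add: P_def)
  qed
  then obtain M where M: "M \<in> P" "\<And>X. X \<in> P \<Longrightarrow> M \<subseteq> X \<Longrightarrow> X = M" by blast
  have "K = M \<or> K = carrier R" if "left_ideal K R" "M \<subseteq> K" for K
    using that M left_ideal_eq_carrier[of K] unfolding P_def by blast
  then have "maximal_left_ideal M R"
    using M(1) unfolding maximal_left_ideal_def P_def by auto
  then show ?thesis using M(1) by (auto simp: P_def)
qed

text \<open>The set is the kernel of \<open>y \<mapsto> y r\<close> as a map into the simple left module \<open>R/M\<close>, where \<open>r\<close> is
  nonzero. It is maximal because for every \<open>k\<close> outside it \<open>R = M + R k r\<close> by maximality of \<open>M\<close>.
  Writing \<open>r = m + t k r\<close> puts \<open>1 - t k\<close> into the set, so any larger left ideal containing \<open>k\<close>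
  contains 1.\<close>

lemma maximal_left_ideal_colon:
  assumes M: "maximal_left_ideal M R" and r: "r \<in> carrier R" "r \<notin> M"
  shows "maximal_left_ideal {y \<in> carrier R. y \<otimes> r \<in> M} R" (is "maximal_left_ideal ?N R")
proof -
  have lM: "left_ideal M R" and max: "\<And>I. left_ideal I R \<Longrightarrow> M \<subseteq> I \<Longrightarrow> I = M \<or> I = carrier R"
    using M unfolding maximal_left_ideal_def by auto
  note MD = left_idealD[OF lM]
  have "left_ideal ?N R"
    using r MD by (intro left_idealI) (auto simp: l_distr m_assoc)
  moreover have "\<one> \<notin> ?N" using r by simp
  then have "?N \<noteq> carrier R" by blast
  moreover have "K = ?N \<or> K = carrier R" if K: "left_ideal K R" "?N \<subseteq> K" for K
  proof (rule disjCI)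
    assume "K \<noteq> carrier R"
    note KD = left_idealD[OF K(1)]
    show "K = ?N"
    proof (rule ccontr)
      assume "K \<noteq> ?N"
      then obtain k where k: "k \<in> K" "k \<notin> ?N" using K(2) by blast
      then have kc: "k \<in> carrier R" "k \<otimes> r \<notin> M" using KD(1) by auto
      define L where "L = {m \<oplus> t \<otimes> (k \<otimes> r) | m t. m \<in> M \<and> t \<in> carrier R}"
      have LI: "m \<oplus> t \<otimes> (k \<otimes> r) \<in> L" if "m \<in> M" "t \<in> carrier R" for m t
        using that by (auto simp: L_def)
      have "left_ideal L R"
      proof (rule left_idealI)
        show "L \<subseteq> carrier R" using MD(1) kc r by (auto simp: L_def)
        show "\<zero> \<in> L" using LI[OF MD(2), of \<zero>] kc r by simp
      next
        fix a b assume "a \<in> L" "b \<in> L"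
        then obtain m t n s where *: "m \<in> M" "t \<in> carrier R" "n \<in> M" "s \<in> carrier R"
          "a = m \<oplus> t \<otimes> (k \<otimes> r)" "b = n \<oplus> s \<otimes> (k \<otimes> r)" unfolding L_def by blast
        have mn: "m \<in> carrier R" "n \<in> carrier R" using * MD(1) by auto
        have "a \<oplus> b = (m \<oplus> n) \<oplus> (t \<oplus> s) \<otimes> (k \<otimes> r)"
          unfolding *(5,6) using mn *(2,4) kc(1) r(1) by algebra
        then show "a \<oplus> b \<in> L" using LI[of "m \<oplus> n" "t \<oplus> s"] * MD(3) by simp
      next
        fix x a assume x: "x \<in> carrier R" and "a \<in> L"
        then obtain m t where *: "m \<in> M" "t \<in> carrier R" "a = m \<oplus> t \<otimes> (k \<otimes> r)"
          unfolding L_def by blast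
        have "m \<in> carrier R" using * MD(1) by auto
        then have "x \<otimes> a = x \<otimes> m \<oplus> (x \<otimes> t) \<otimes> (k \<otimes> r)"
          unfolding *(3) using x *(2) kc(1) r(1) by (simp add: r_distr m_assoc)
        then show "x \<otimes> a \<in> L" using LI[of "x \<otimes> m" "x \<otimes> t"] * x MD(4) by simp
      qed
      moreover have "M \<subseteq> L"
      proof
        fix m assume "m \<in> M"
        then show "m \<in> L" using LI[of m \<zero>] MD(1) kc r by auto
      qed
      moreover have "k \<otimes> r \<in> L" using LI[OF MD(2), of \<one>] kc r by simp
      ultimately have "L = carrier R" using max[of L] kc(2) by blast
      then obtain m t where mt: "m \<in> M" "t \<in> carrier R" "r = m \<oplus> t \<otimes> (k \<otimes> r)"
        using r(1) unfolding L_def by blast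
      have mc: "m \<in> carrier R" using mt MD(1) by auto
      have "(\<one> \<ominus> t \<otimes> k) \<otimes> r = r \<ominus> t \<otimes> (k \<otimes> r)"
        using mt(2) kc(1) r(1) by algebra
      also have "\<dots> = (m \<oplus> t \<otimes> (k \<otimes> r)) \<ominus> t \<otimes> (k \<otimes> r)"
        using mt(3) by simp
      also have "\<dots> = m" using mc mt(2) kc(1) r(1) by algebra
      finally have "\<one> \<ominus> t \<otimes> k \<in> K"
        using K(2) mt kc by auto
      then have "(\<one> \<ominus> t \<otimes> k) \<oplus> t \<otimes> k \<in> K"
        using KD(3,4) k mt by blast
      moreover have "(\<one> \<ominus> t \<otimes> k) \<oplus> t \<otimes> k = \<one>"
        using mt(2) kc(1) by algebra
      ultimately show False
        using left_ideal_eq_carrier[OF K(1)] \<open>K \<noteq> carrier R\<close> by simp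
    qed
  qed
  ultimately show ?thesis unfolding maximal_left_ideal_def by blast
qed

lemma jacobson_radical_left_ideal: "left_ideal (jacobson_radical R) R"
proof (rule left_idealI)
  have M: "left_ideal M R" if "maximal_left_ideal M R" for M
    using that unfolding maximal_left_ideal_def by blast
  show "\<zero> \<in> jacobson_radical R"
    using left_idealD(2)[OF M] by (auto simp: jacobson_radical_def)
  show "a \<oplus> b \<in> jacobson_radical R" if "a \<in> jacobson_radical R" "b \<in> jacobson_radical R" for a b
    using that left_idealD(3)[OF M] by (auto simp: jacobson_radical_def)
  show "x \<otimes> a \<in> jacobson_radical R" if "x \<in> carrier R" "a \<in> jacobson_radical R" for x a
    using that left_idealD(4)[OF M] by (auto simp: jacobson_radical_def)
qed (auto simp: jacobson_radical_def)

text \<open>Closure under right multiplication by \<open>r\<close> is the nontrivial part. If a maximal left ideal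
  \<open>M\<close> does not contain \<open>r\<close>, then an element of the radical lies in the maximal left ideal of all
  \<open>y\<close> with \<open>y r \<in> M\<close>.\<close>

lemma jacobson_radical_ideal: "ideal (jacobson_radical R) R"
proof (rule idealI)
  show "ring R" by (rule ring_axioms)
  show "subgroup (jacobson_radical R) (add_monoid R)"
    using jacobson_radical_left_ideal unfolding left_ideal_def additive_subgroup_def by blast
  show "x \<otimes> a \<in> jacobson_radical R" if "a \<in> jacobson_radical R" "x \<in> carrier R" for a x
    using that left_idealD(4)[OF jacobson_radical_left_ideal] by blast
  show "a \<otimes> r \<in> jacobson_radical R" if a: "a \<in> jacobson_radical R" and r: "r \<in> carrier R" for a r
    unfolding jacobson_radical_def
  proof (intro CollectI conjI allI impI)
    show "a \<otimes> r \<in> carrier R" using a r by (auto simp: jacobson_radical_def)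
    fix M assume M: "maximal_left_ideal M R"
    show "a \<otimes> r \<in> M"
    proof (cases "r \<in> M")
      case True
      then show ?thesis
        using M a left_idealD(4)[of M R a r]
        by (auto simp: maximal_left_ideal_def jacobson_radical_def)
    next
      case False
      then show ?thesis
        using maximal_left_ideal_colon[OF M r] a by (auto simp: jacobson_radical_def)
    qed
  qed
qed

text \<open>The left annihilator of \<open>e\<close> contains \<open>1 - e\<close>. If it were proper, a maximal left ideal above it
  would contain both \<open>1 - e\<close> and the radical element \<open>e\<close>, hence 1. So 1 annihilates \<open>e\<close>.\<close>

lemma jacobson_radical_idempotent_zero:
  assumes e: "idempotent_elem R e" "e \<in> jacobson_radical R"
  shows "e = \<zero>"
proof -
  have ec: "e \<in> carrier R" using e by (auto simp: idempotent_elem_def)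
  define I where "I = {y \<in> carrier R. y \<otimes> e = \<zero>}"
  have I: "left_ideal I R"
    using ec unfolding I_def by (intro left_idealI) (auto simp: l_distr m_assoc)
  have "\<one> \<in> I"
  proof (rule ccontr)
    assume "\<one> \<notin> I"
    then obtain M where M: "maximal_left_ideal M R" "I \<subseteq> M"
      using maximal_left_ideal_ex I by blast
    then have lM: "left_ideal M R" "M \<noteq> carrier R" by (auto simp: maximal_left_ideal_def)
    have "\<one> \<ominus> e \<in> M" using M(2) ec idempotent_complement(3)[OF e(1)] by (auto simp: I_def)
    moreover have "e \<in> M" using e M(1) by (auto simp: jacobson_radical_def)
    ultimately have "(\<one> \<ominus> e) \<oplus> e \<in> M" using left_idealD(3)[OF lM(1)] by blast
    moreover have "(\<one> \<ominus> e) \<oplus> e = \<one>" using ec by algebra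
    ultimately show False using left_ideal_eq_carrier lM by simp
  qed
  then show ?thesis using ec by (simp add: I_def)
qed

text \<open>Decomposing \<open>1 + x\<close> instead of \<open>x\<close> makes the idempotent congruent to the unit \<open>1 - l\<close>; an
  idempotent that is a unit is 1.\<close>

lemma nil_jacobson_radical:
  assumes "conjugate_nil_clean R"
  shows "nil_set R (jacobson_radical R)"
  unfolding nil_set_def
proof
  fix x assume x: "x \<in> jacobson_radical R"
  let ?J = "jacobson_radical R"
  interpret J: ideal ?J R by (rule jacobson_radical_ideal)
  interpret q: ring_hom_ring R "R Quot ?J" "(+>) ?J" by (rule J.rcos_ring_hom_ring)
  have xc: "x \<in> carrier R" using x by auto
  then have "\<one> \<oplus> x \<in> carrier R" by simp
  then obtain e l where e: "idempotent_elem R e" and l: "nilpotent_elem R l"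
    and eq: "\<one> \<oplus> x = e \<oplus> l"
    using assms unfolding conjugate_nil_clean_def nil_clean_decomp_def by blast
  have carr: "e \<in> carrier R" "l \<in> carrier R"
    using e l by (auto simp: idempotent_elem_def nilpotent_elem_def)
  have "e \<ominus> (\<one> \<ominus> l) = (e \<oplus> l) \<ominus> \<one>" using carr by algebra
  also have "\<dots> = x" unfolding eq[symmetric] using xc by algebra
  finally have "?J +> e = ?J +> (\<one> \<ominus> l)"
    using quotient_eq_iff_same_a_r_cos[OF jacobson_radical_ideal, of e "\<one> \<ominus> l"] carr x by simp
  then have "?J +> e \<in> Units (R Quot ?J)"
    using q.hom_Units[OF one_minus_nilpotent_in_Units[OF l]] by simp
  moreover have "idempotent_elem (R Quot ?J) (?J +> e)"
    by (rule q.hom_idempotent[OF e])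
  ultimately have "?J +> e = ?J +> \<one>"
    using q.S.Units_l_cancel[of "?J +> e" "?J +> e" "\<one>\<^bsub>R Quot ?J\<^esub>"]
    by (simp add: idempotent_elem_def)
  then have "\<one> \<ominus> e \<in> ?J"
    using quotient_eq_iff_same_a_r_cos[OF jacobson_radical_ideal, of \<one> e] carr by simp
  then have "\<one> \<ominus> e = \<zero>"
    using jacobson_radical_idempotent_zero idempotent_complement(1)[OF e] by blast
  then have "e = \<one>" using carr by simp
  then have "x = l" using eq carr xc by simp
  then show "nilpotent_elem R x" using l by simp
qed

end

section \<open>Quotients by nil ideals\<close>

context ring begin

lemma rcos_eq_zero_iff:
  assumes "ideal I R" "x \<in> carrier R"
  shows "I +> x = \<zero>\<^bsub>R Quot I\<^esub> \<longleftrightarrow> x \<in> I"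
proof -
  interpret I: ideal I R by fact
  have "I +> \<zero> = \<zero>\<^bsub>R Quot I\<^esub>"
    using a_rcos_zero[OF assms(1) I.zero_closed] by (simp add: FactRing_def)
  moreover have "x \<ominus> \<zero> = x" using assms(2) by (simp add: minus_eq)
  ultimately show ?thesis
    using quotient_eq_iff_same_a_r_cos[OF assms zero_closed] by simp
qed

lemma carrier_Quot: "carrier (R Quot I) = (+>) I ` carrier R"
  unfolding FactRing_def A_RCOSETS_def' by (simp add: image_def) blast

lemma nil_kernel_epi_Quot:
  assumes I: "ideal I R" and "nil_set R I"
  shows "nil_kernel_epi R (R Quot I) ((+>) I)"
proof -
  interpret I: ideal I R by fact
  show ?thesis
  proof (intro nil_kernel_epi.intro nil_kernel_epi_axioms.intro)
    show "ring_hom_ring R (R Quot I) ((+>) I)" by (rule I.rcos_ring_hom_ring)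
    show "(+>) I ` carrier R = carrier (R Quot I)" by (rule carrier_Quot[symmetric])
    show "nilpotent_elem R x" if "x \<in> carrier R" "I +> x = \<zero>\<^bsub>R Quot I\<^esub>" for x
      using that assms(2) rcos_eq_zero_iff[OF I that(1)] by (simp add: nil_set_def)
  qed
qed

text \<open>The coset of \<open>a + x\<close> with \<open>x \<in> I\<close> is the coset of \<open>a\<close>, whence surjectivity. The kernel is
  \<open>A \<inter> I\<close>, and nilpotency in \<open>A\<close> and in \<open>R\<close> agree.\<close>

lemma nil_kernel_epi_subring_Quot:
  assumes I: "ideal I R" and nil: "nil_set R I"
    and A: "subring A R" and sum: "carrier R = A <+> I"
  shows "nil_kernel_epi (R\<lparr>carrier := A\<rparr>) (R Quot I) ((+>) I)"
proof -
  interpret I: ideal I R by fact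
  interpret q: ring_hom_ring R "R Quot I" "(+>) I" by (rule I.rcos_ring_hom_ring)
  let ?A = "R\<lparr>carrier := A\<rparr>"
  note AE = subringE[OF A]
  have AR: "a \<in> carrier R" if "a \<in> A" for a using that AE(1) by blast
  interpret A: ring ?A by (rule subring_is_ring[OF A])
  have "(+>) I \<in> ring_hom ?A (R Quot I)"
    using AR by (intro ring_hom_memI) auto
  then interpret h: ring_hom_ring ?A "R Quot I" "(+>) I"
    by unfold_locales
  show ?thesis
  proof (intro nil_kernel_epi.intro nil_kernel_epi_axioms.intro)
    show "ring_hom_ring ?A (R Quot I) ((+>) I)" by (rule h.ring_hom_ring_axioms)
    show "(+>) I ` carrier ?A = carrier (R Quot I)"
    proof
      show "(+>) I ` carrier ?A \<subseteq> carrier (R Quot I)" using h.hom_closed by blast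
      show "carrier (R Quot I) \<subseteq> (+>) I ` carrier ?A"
      proof
        fix X assume "X \<in> carrier (R Quot I)"
        then obtain r where r: "r \<in> carrier R" "X = I +> r"
          unfolding carrier_Quot by blast
        then obtain a x where ax: "a \<in> A" "x \<in> I" "r = a \<oplus> x"
          using sum unfolding set_add_def' by blast
        then have "r \<ominus> a = x" using AR[of a] I.Icarr[of x] by (simp, algebra)
        then have "X = I +> a"
          using quotient_eq_iff_same_a_r_cos[OF I r(1), of a] ax AR r by auto
        then show "X \<in> (+>) I ` carrier ?A" using ax by simp
      qed
    qed
    show "nilpotent_elem ?A x" if "x \<in> carrier ?A" "I +> x = \<zero>\<^bsub>R Quot I\<^esub>" for x
    proof -
      have "x \<in> I" using that AR rcos_eq_zero_iff[OF I, of x] by simp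
      then show ?thesis
        using nil that(1) by (simp add: nil_set_def nilpotent_elem_def nat_pow_consistent[symmetric])
    qed
  qed
qed

end

section \<open>Characterizations of conjugate nil clean rings\<close>

theorem corollary2p16:
  fixes R :: "('a, 'b) ring_scheme"
  assumes "ring R"
  shows "(conjugate_nil_clean R \<longleftrightarrow>
            nil_set R (jacobson_radical R) \<and> conjugate_nil_clean (R Quot jacobson_radical R)) \<and>
         (conjugate_nil_clean R \<longleftrightarrow>
            nil_set R (jacobson_radical R) \<and>
            (\<exists>A. subring A R \<and> conjugate_nil_clean (R\<lparr>carrier := A\<rparr>) \<and>
                 carrier R = A <+>\<^bsub>R\<^esub> jacobson_radical R \<and>
                 (\<forall>g. idempotent_elem R g \<longrightarrow>
                    (\<exists>e x. e \<in> A \<and> e \<otimes>\<^bsub>R\<^esub> e = e \<and> x \<in> jacobson_radical R \<and> g = e \<oplus>\<^bsub>R\<^esub> x))))"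
    (is "(?cnc \<longleftrightarrow> ?quot) \<and> (?cnc \<longleftrightarrow> ?sub)")
proof -
  interpret ring R by fact
  let ?J = "jacobson_radical R"
  note J = jacobson_radical_ideal
  interpret J: ideal ?J R by (rule J)
  have iff: "?cnc \<longleftrightarrow> conjugate_nil_clean (R Quot ?J)" if "nil_set R ?J"
    using nil_kernel_epi.conjugate_nil_clean_iff[OF nil_kernel_epi_Quot[OF J that]] .
  have quot: "?cnc \<longleftrightarrow> ?quot"
    using iff nil_jacobson_radical by blast
  moreover have ?sub if ?cnc
  proof (intro conjI exI[of _ "carrier R"] allI impI)
    show "nil_set R ?J" using that by (rule nil_jacobson_radical)
    show "subring (carrier R) R" by (rule carrier_is_subring)
    show "conjugate_nil_clean (R\<lparr>carrier := carrier R\<rparr>)" using that by simp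
    show "carrier R = carrier R <+>\<^bsub>R\<^esub> ?J"
    proof
      show "carrier R \<subseteq> carrier R <+>\<^bsub>R\<^esub> ?J"
      proof
        fix r assume "r \<in> carrier R"
        then have "r = r \<oplus>\<^bsub>R\<^esub> \<zero>\<^bsub>R\<^esub>" by simp
        then show "r \<in> carrier R <+>\<^bsub>R\<^esub> ?J"
          using \<open>r \<in> carrier R\<close> J.zero_closed unfolding set_add_def' by blast
      qed
      show "carrier R <+>\<^bsub>R\<^esub> ?J \<subseteq> carrier R"
        using J.Icarr unfolding set_add_def' by auto
    qed
    fix g assume "idempotent_elem R g"
    then show "\<exists>e x. e \<in> carrier R \<and> e \<otimes>\<^bsub>R\<^esub> e = e \<and> x \<in> ?J \<and> g = e \<oplus>\<^bsub>R\<^esub> x"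
      using J.zero_closed by (intro exI[of _ g] exI[of _ "\<zero>\<^bsub>R\<^esub>"]) (auto simp: idempotent_elem_def)
  qed
  moreover have ?cnc if sub: ?sub
  proof -
    obtain A where A: "nil_set R ?J" "subring A R" "conjugate_nil_clean (R\<lparr>carrier := A\<rparr>)"
      "carrier R = A <+>\<^bsub>R\<^esub> ?J" using sub by blast
    have "conjugate_nil_clean (R Quot ?J)"
      using A(3) nil_kernel_epi.conjugate_nil_clean_iff[OF nil_kernel_epi_subring_Quot[OF J A(1,2,4)]]
      by simp
    then show ?cnc using iff A(1) by simp
  qed
  ultimately show ?thesis by blast
qed

end
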